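(* Let $X$ be a $\mathbb{Z}^2$-subshift and let $P$ be a coding polygon for $X$. If $\ell$ is a nonexpansive ray in $X$, then $\ell$ is positively parallel to an edge of $P$ (with $P$ given its boundary orientation), i.e. to an edge whose orientation matches the orientation of $\ell$.
   Context: For a finite alphabet $\mathcal{A}$ (discrete topology), a $\mathbb{Z}^2$-subshift is a closed subset $X\subset\mathcal{A}^{\mathbb{Z}^2}$ (product topology) invariant under the shifts $(T^ux)(v)=x(u+v)$, $u\in\mathbb{Z}^2$. For $A,B\subset\mathbb{R}^2$, $A$ $X$-codes $B$ if whenever $x,x'\in X$ agree on $A\cap\mathbb{Z}^2$ they agree on $B\cap\mathbb{Z}^2$. An integer polygon is a polygon in $\mathbb{R}^2$ (including its interior) with all vertices in $\mathbb{Z}^2$. A convex integer polygon $P$ is a coding polygon for an infinite $\mathbb{Z}^2$-subshift $X$ if for every vertex $v$ of $P$, $P\setminus\{v\}$ $X$-codes $\{v\}$. The edges of $P$ carry the orientation that $\partial P$ inherits from $\mathbb{R}^2$ (counterclockwise). A ray is a translate of $\{tv: t\ge 0\}$, $v\neq0$ in $\mathbb{R}^2$, oriented in the direction of increasing $t$. An oriented line segment is positively parallel to a ray if a translate of it lies in the ray with matching orientation. A half space $H\subset\mathbb{R}^2$ (open or closed half plane) is expansive for $X$ if $H$ $X$-codes $\mathbb{R}^2$, and nonexpansive otherwise; this depends only on $H$ up to translation. A ray $\ell$ is expansive (nonexpansive) for $X$ if the half space $H$ bounded by the line containing $\ell$ and lying to the left of $\ell$ (so that $\ell$ has the orientation that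 $\partial H$ inherits from $H$) is expansive (nonexpansive). *)

theory Defs
  imports "HOL-Analysis.Analysis"
begin

text \<open>
  The alphabet is a finite type \<open>'a\<close>, the group \<open>\<int>\<^sup>2\<close> is \<^typ>\<open>int \<times> int\<close> and the plane
  is \<^typ>\<open>real \<times> real\<close>; \<open>of_lattice\<close> is the inclusion of the former in the latter.
\<close>

type_synonym 'a config = "int \<times> int \<Rightarrow> 'a"
type_synonym plane = "real \<times> real"

definition of_lattice :: "int \<times> int \<Rightarrow> plane" where
  "of_lattice u = (real_of_int (fst u), real_of_int (snd u))"

definition shift :: "int \<times> int \<Rightarrow> 'a config \<Rightarrow> 'a config" where
  "shift u x = (\<lambda>v. x (u + v))"

definition subshift :: "('a::finite) config set \<Rightarrow> bool" where
  "subshift X \<longleftrightarrow>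
     closedin (product_topology (\<lambda>_. discrete_topology (UNIV :: 'a set)) UNIV) X \<and>
     (\<forall>u. shift u ` X = X)"

definition codes :: "'a config set \<Rightarrow> plane set \<Rightarrow> plane set \<Rightarrow> bool" where
  "codes X A B \<longleftrightarrow>
     (\<forall>x\<in>X. \<forall>x'\<in>X.
        (\<forall>u. of_lattice u \<in> A \<longrightarrow> x u = x' u) \<longrightarrow>
        (\<forall>u. of_lattice u \<in> B \<longrightarrow> x u = x' u))"

text \<open>Polygons are two-dimensional, and their vertices are their extreme points.\<close>

definition convex_integer_polygon :: "plane set \<Rightarrow> bool" where
  "convex_integer_polygon P \<longleftrightarrow>
     polytope P \<and> aff_dim P = 2 \<and> {v. v extreme_point_of P} \<subseteq> range of_lattice"

definition coding_polygon :: "'a config set \<Rightarrow> plane set \<Rightarrow> bool" where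
  "coding_polygon X P \<longleftrightarrow>
     infinite X \<and> convex_integer_polygon P \<and>
     (\<forall>v. v extreme_point_of P \<longrightarrow> codes X (P - {v}) {v})"

text \<open>The closed half plane to the left of the line through \<open>a\<close> directed by \<open>d\<close>: the points
  \<open>p\<close> for which the determinant of \<open>(d, p - a)\<close> is nonnegative.\<close>

definition left_half_plane :: "plane \<Rightarrow> plane \<Rightarrow> plane set" where
  "left_half_plane a d = {p. 0 \<le> fst d * snd (p - a) - snd d * fst (p - a)}"

text \<open>The edge of \<open>P\<close> from \<open>a\<close> to \<open>b\<close> has the counterclockwise orientation if and only if
  \<open>P\<close> lies to its left.\<close>

definition oriented_edge :: "plane set \<Rightarrow> plane \<Rightarrow> plane \<Rightarrow> bool" where
  "oriented_edge P a b \<longleftrightarrow>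
     closed_segment a b edge_of P \<and> P \<subseteq> left_half_plane a (b - a)"

definition ray :: "plane \<Rightarrow> plane \<Rightarrow> plane set" where
  "ray a d = {a + t *\<^sub>R d | t. 0 \<le> t}"

text \<open>A ray is treated as a set of points; it determines its initial point \<open>a\<close> and, up to a
  positive factor, its direction \<open>d\<close>, so the choice of \<open>a\<close> and \<open>d\<close> in the next two
  definitions does not matter.\<close>

definition positively_parallel :: "plane \<Rightarrow> plane \<Rightarrow> plane set \<Rightarrow> bool" where
  "positively_parallel p q l \<longleftrightarrow>
     (\<exists>a d c. d \<noteq> 0 \<and> l = ray a d \<and>
        (\<lambda>z. c + z) ` closed_segment p q \<subseteq> l \<and>
        (\<exists>s t. s < t \<and> c + p = a + s *\<^sub>R d \<and> c + q = a + t *\<^sub>R d))"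

definition expansive :: "'a config set \<Rightarrow> plane set \<Rightarrow> bool" where
  "expansive X H \<longleftrightarrow> codes X H UNIV"

text \<open>For a subshift, expansiveness of a half plane is invariant under translation and does not
  depend on whether the bounding line is included; the closed half plane is used here.\<close>

definition nonexpansive_ray :: "'a config set \<Rightarrow> plane set \<Rightarrow> bool" where
  "nonexpansive_ray X l \<longleftrightarrow>
     (\<exists>a d. d \<noteq> 0 \<and> l = ray a d \<and> \<not> expansive X (left_half_plane a d))"

end

theory Submission
  imports Defs
begin

text \<open>
  Write \<open>[d, p]\<close> for the determinant of the plane vectors \<open>d\<close> and \<open>p\<close>, so that the half planes to
  the left of a line directed by \<open>d\<close> are the superlevel sets of \<open>[d, _]\<close>. This functional attains
  its minimum over \<open>P\<close> on a face of \<open>P\<close>, which lies on a line directed by \<open>d\<close>; it is therefore a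
  vertex or an edge.

  If it is an edge, then \<open>P\<close> lies on the left of that edge when the edge is oriented like \<open>d\<close>, so
  this edge is positively parallel to every ray of direction \<open>d\<close>.

  If it is a single vertex \<open>v\<close>, every half plane to the left of a line directed by \<open>d\<close> is
  expansive. Indeed, the finitely many other lattice points of \<open>P\<close> exceed \<open>v\<close> in the value of
  \<open>[d, _]\<close> by at least some \<open>\<delta> > 0\<close>. If two configurations agree where \<open>[d, _] \<ge> c\<close>, then for a
  lattice point \<open>u\<close> with \<open>[d, u] \<ge> c - \<delta>\<close> they agree on the translate of \<open>P\<close> that carries \<open>v\<close> to
  \<open>u\<close>, except possibly at \<open>u\<close>, and hence also at \<open>u\<close> because \<open>P - {v}\<close> codes \<open>v\<close>. The half plane
  of agreement thus grows by the fixed width \<open>\<delta>\<close>, and repeating the step exhausts the plane. The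
  uniform \<open>\<delta>\<close> is what makes the argument insensitive to whether the slope of \<open>d\<close> is rational.
\<close>

section \<open>Determinants and lattice points\<close>

definition plane_det :: "plane \<Rightarrow> plane \<Rightarrow> real" where
  "plane_det d p = fst d * snd p - snd d * fst p"

lemma plane_det_add: "plane_det d (p + q) = plane_det d p + plane_det d q"
  and plane_det_diff: "plane_det d (p - q) = plane_det d p - plane_det d q"
  and plane_det_scaleR_left: "plane_det (t *\<^sub>R d) p = t * plane_det d p"
  by (simp_all add: plane_det_def algebra_simps)

lemma plane_det_eq_inner: "plane_det d p = (- snd d, fst d) \<bullet> p"
  by (simp add: plane_det_def inner_prod_def)

lemma mem_left_half_plane: "p \<in> left_half_plane a d \<longleftrightarrow> plane_det d a \<le> plane_det d p"
  by (auto simp: left_half_plane_def plane_det_def algebra_simps)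

lemma plane_det_eq_0_imp_multiple:
  assumes "d \<noteq> 0" "plane_det d p = 0"
  obtains t where "p = t *\<^sub>R d"
proof (cases "fst d = 0")
  case True
  with assms have "p = (snd p / snd d) *\<^sub>R d"
    by (auto simp: plane_det_def prod_eq_iff)
  then show ?thesis by (rule that)
next
  case False
  with assms have "p = (fst p / fst d) *\<^sub>R d"
    by (auto simp: plane_det_def prod_eq_iff field_simps)
  then show ?thesis by (rule that)
qed

lemma of_lattice_add: "of_lattice (u + w) = of_lattice u + of_lattice w"
  and of_lattice_diff: "of_lattice (u - w) = of_lattice u - of_lattice w"
  by (simp_all add: of_lattice_def)

lemma finite_lattice_points:
  assumes "bounded P"
  shows "finite {u. of_lattice u \<in> P}"
proof -
  obtain B where B: "\<And>p. p \<in> P \<Longrightarrow> norm p \<le> B"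
    using assms by (auto simp: bounded_iff)
  have "{u. of_lattice u \<in> P} \<subseteq> {-\<lceil>B\<rceil>..\<lceil>B\<rceil>} \<times> {-\<lceil>B\<rceil>..\<lceil>B\<rceil>}"
  proof
    fix u assume "u \<in> {u. of_lattice u \<in> P}"
    then have "norm (of_lattice u) \<le> B" using B by blast
    then have "\<bar>real_of_int (fst u)\<bar> \<le> B" "\<bar>real_of_int (snd u)\<bar> \<le> B"
      using norm_fst_le[of "real_of_int (fst u)" "real_of_int (snd u)"]
        norm_snd_le[of "real_of_int (snd u)" "real_of_int (fst u)"]
      by (auto simp: of_lattice_def)
    then have "\<bar>fst u\<bar> \<le> \<lceil>B\<rceil>" "\<bar>snd u\<bar> \<le> \<lceil>B\<rceil>"
      by linarith+
    then show "u \<in> {-\<lceil>B\<rceil>..\<lceil>B\<rceil>} \<times> {-\<lceil>B\<rceil>..\<lceil>B\<rceil>}"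
      by (cases u) (simp add: abs_le_iff)
  qed
  then show ?thesis by (rule finite_subset) simp
qed

text \<open>At points of \<open>P\<close> close to \<open>v\<close> the value of \<open>[d, _]\<close> is close to its minimum, so strictness
  alone gives no uniform gap. It is the finiteness of the set of lattice points of \<open>P\<close> that does.\<close>

lemma lattice_gap_at_strict_minimum:
  assumes "bounded P"
    and min: "\<And>p. p \<in> P - {v} \<Longrightarrow> plane_det d v < plane_det d p"
  obtains \<delta> where "\<delta> > 0"
    and "\<And>u. of_lattice u \<in> P - {v} \<Longrightarrow> plane_det d v + \<delta> \<le> plane_det d (of_lattice u)"
proof -
  define G where
    "G = (\<lambda>u. plane_det d (of_lattice u) - plane_det d v) ` {u. of_lattice u \<in> P - {v}}"
  have "{u. of_lattice u \<in> P - {v}} \<subseteq> {u. of_lattice u \<in> P}"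
    by auto
  then have "finite G"
    unfolding G_def using finite_lattice_points[OF \<open>bounded P\<close>] by (metis finite_imageI finite_subset)
  show ?thesis
  proof
    \<comment> \<open>The value 1 only keeps the minimum defined when \<open>P - {v}\<close> has no lattice points.\<close>
    show "Min (insert 1 G) > 0"
      using \<open>finite G\<close> min by (auto simp: G_def)
  next
    fix u assume "of_lattice u \<in> P - {v}"
    then have "plane_det d (of_lattice u) - plane_det d v \<in> insert 1 G"
      by (auto simp: G_def)
    then have "Min (insert 1 G) \<le> plane_det d (of_lattice u) - plane_det d v"
      using \<open>finite G\<close> by (intro Min_le) auto
    then show "plane_det d v + Min (insert 1 G) \<le> plane_det d (of_lattice u)"
      by simp
  qed
qed

section \<open>Expansiveness from a coded vertex\<close>

lemma codes_translate:
  assumes shift: "\<And>u. shift u ` X \<subseteq> X"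
    and code: "codes X (P - {of_lattice w}) {of_lattice w}"
    and "x \<in> X" "x' \<in> X"
    and agree: "\<And>z. of_lattice z \<in> P - {of_lattice w} \<Longrightarrow> x (u - w + z) = x' (u - w + z)"
  shows "x u = x' u"
proof -
  have "shift (u - w) x \<in> X" "shift (u - w) x' \<in> X"
    using shift \<open>x \<in> X\<close> \<open>x' \<in> X\<close> by blast+
  moreover have "\<forall>z. of_lattice z \<in> P - {of_lattice w} \<longrightarrow> shift (u - w) x z = shift (u - w) x' z"
    using agree by (simp add: shift_def)
  ultimately have "shift (u - w) x w = shift (u - w) x' w"
    using code unfolding codes_def by (meson singletonI)
  then show ?thesis by (simp add: shift_def)
qed

text \<open>Coding the lattice point \<open>w\<close> at all suitable translates of \<open>P\<close> widens the half plane
  of agreement by the gap \<open>\<delta>\<close> between \<open>w\<close> and the other lattice points of \<open>P\<close>, so finitely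
  many repetitions reach any given lattice point.\<close>

lemma expansive_if_strict_minimum_at_coded_vertex:
  assumes shift: "\<And>u. shift u ` X \<subseteq> X"
    and "bounded P"
    and code: "codes X (P - {of_lattice w}) {of_lattice w}"
    and min: "\<And>p. p \<in> P - {of_lattice w} \<Longrightarrow> plane_det d (of_lattice w) < plane_det d p"
  shows "expansive X (left_half_plane a d)"
proof -
  obtain \<delta> where "\<delta> > 0" and gap: "\<And>z. of_lattice z \<in> P - {of_lattice w} \<Longrightarrow>
      plane_det d (of_lattice w) + \<delta> \<le> plane_det d (of_lattice z)"
    using lattice_gap_at_strict_minimum[OF \<open>bounded P\<close> min] by blast
  have "x u = x' u"
    if "x \<in> X" "x' \<in> X"
      and agree: "\<And>u. of_lattice u \<in> left_half_plane a d \<Longrightarrow> x u = x' u" for x x' u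
  proof -
    have grow: "\<forall>u. plane_det d a - real n * \<delta> \<le> plane_det d (of_lattice u) \<longrightarrow> x u = x' u" for n
    proof (induction n)
      case 0
      then show ?case using agree by (simp add: mem_left_half_plane)
    next
      case (Suc n)
      show ?case
      proof (intro allI impI)
        fix u assume u: "plane_det d a - real (Suc n) * \<delta> \<le> plane_det d (of_lattice u)"
        show "x u = x' u"
        proof (rule codes_translate[OF shift code \<open>x \<in> X\<close> \<open>x' \<in> X\<close>])
          fix z assume "of_lattice z \<in> P - {of_lattice w}"
          then have "plane_det d a - real n * \<delta> \<le> plane_det d (of_lattice (u - w + z))"
            using gap[of z] u
            by (simp add: of_lattice_add of_lattice_diff plane_det_add plane_det_diff algebra_simps)
          then show "x (u - w + z) = x' (u - w + z)"
            using Suc.IH by blast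
        qed
      qed
    qed
    obtain n where "plane_det d a - plane_det d (of_lattice u) < real n * \<delta>"
      using reals_Archimedean3[OF \<open>\<delta> > 0\<close>] by blast
    then show ?thesis
      using grow[of n] by (smt (verit))
  qed
  then show ?thesis
    unfolding expansive_def codes_def by meson
qed

section \<open>The minimal face of the polygon\<close>

text \<open>The minimal face of \<open>[d, _]\<close> is compact, convex and contained in a line, so it is a segment;
  the degenerate segment is the case of a vertex. The orientation of an edge is chosen to be that
  of \<open>d\<close>.\<close>

lemma minimal_vertex_or_edge:
  assumes "polytope P" "P \<noteq> {}" "d \<noteq> 0"
  obtains
    (vertex) v where "v extreme_point_of P"
      "\<And>p. p \<in> P - {v} \<Longrightarrow> plane_det d v < plane_det d p"
  | (edge) p q t where "t > 0" "q = p + t *\<^sub>R d" "oriented_edge P p q"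
proof -
  have "compact P" "convex P"
    using \<open>polytope P\<close> by (auto simp: polytope_imp_compact polytope_imp_convex)
  have "continuous_on P (plane_det d)"
    unfolding plane_det_def by (intro continuous_intros)
  then obtain m where "m \<in> P" and m: "\<And>p. p \<in> P \<Longrightarrow> plane_det d m \<le> plane_det d p"
    using continuous_attains_inf[OF \<open>compact P\<close> \<open>P \<noteq> {}\<close>] by blast
  define F where "F = P \<inter> {p. plane_det d p = plane_det d m}"
  have face: "F face_of P"
    unfolding F_def plane_det_eq_inner
    by (rule face_of_Int_supporting_hyperplane_ge[OF \<open>convex P\<close>])
       (use m in \<open>simp add: plane_det_eq_inner\<close>)
  have "m \<in> F"
    using \<open>m \<in> P\<close> by (simp add: F_def)
  have on_line: "\<exists>t. q = p + t *\<^sub>R d" if "p \<in> F" "q \<in> F" for p q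
  proof -
    have "plane_det d (q - p) = 0"
      using that by (simp add: F_def plane_det_diff)
    then obtain t where "q - p = t *\<^sub>R d"
      using plane_det_eq_0_imp_multiple[OF \<open>d \<noteq> 0\<close>] by blast
    then show ?thesis by (metis add.commute diff_add_cancel)
  qed
  have "collinear F"
  proof -
    have "\<exists>c. q - p = c *\<^sub>R d" if "q \<in> F" "p \<in> F" for q p
      using on_line[OF that(2,1)] by auto
    then show ?thesis unfolding collinear_def by blast
  qed
  moreover have "compact F" "convex F"
    using face \<open>compact P\<close> \<open>convex P\<close> by (auto intro: face_of_imp_compact face_of_imp_convex)
  ultimately obtain p q where F: "F = closed_segment p q"
    using compact_convex_collinear_segment \<open>m \<in> F\<close> by (metis empty_iff)
  obtain t where t: "q = p + t *\<^sub>R d"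
    using on_line[of p q] F by auto
  have edge_case: "oriented_edge P p q"
    if "t > 0" and F: "F = closed_segment p q" and q: "q = p + t *\<^sub>R d" for p q :: plane and t
  proof -
    have "p \<noteq> q"
      using \<open>t > 0\<close> q \<open>d \<noteq> 0\<close> by simp
    have "plane_det d p = plane_det d m"
      using F by (auto simp: F_def)
    then have "P \<subseteq> left_half_plane p (q - p)"
      using m \<open>t > 0\<close> by (auto simp: mem_left_half_plane q plane_det_scaleR_left)
    moreover have "closed_segment p q edge_of P"
      using face \<open>p \<noteq> q\<close> F by (simp add: edge_of_def segment_convex_hull aff_dim_convex_hull aff_dim_2)
    ultimately show ?thesis
      by (simp add: oriented_edge_def)
  qed
  consider "t = 0" | "t > 0" | "t < 0" by linarith
  then show ?thesis
  proof cases
    case 1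
    then have "F = {p}"
      using F t by simp
    then have "p = m"
      using \<open>m \<in> F\<close> by simp
    show ?thesis
    proof (rule vertex)
      show "p extreme_point_of P"
        using face \<open>F = {p}\<close> by (simp add: face_of_singleton)
    next
      fix z assume "z \<in> P - {p}"
      then have "z \<notin> F" "z \<in> P"
        using \<open>F = {p}\<close> by auto
      then show "plane_det d p < plane_det d z"
        using m[of z] \<open>p = m\<close> by (auto simp: F_def)
    qed
  next
    case 2
    then show ?thesis
      using edge[OF 2 t] edge_case[OF 2 F t] by blast
  next
    case 3
    then have "- t > 0" "p = q + (- t) *\<^sub>R d" "F = closed_segment q p"
      using t F by (simp_all add: closed_segment_commute)
    then show ?thesis
      using edge edge_case by blast
  qed
qed

section \<open>Nonexpansive rays\<close>

lemma positively_parallel_ray: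
  assumes "d \<noteq> 0" "t > 0" "q = p + t *\<^sub>R d"
  shows "positively_parallel p q (ray a d)"
  unfolding positively_parallel_def
proof (intro exI conjI)
  show "(\<lambda>z. (a - p) + z) ` closed_segment p q \<subseteq> ray a d"
  proof (rule image_subsetI)
    fix z assume "z \<in> closed_segment p q"
    then obtain s where "0 \<le> s" "z = (1 - s) *\<^sub>R p + s *\<^sub>R q"
      by (auto simp: closed_segment_def)
    then have "a - p + z = a + (s * t) *\<^sub>R d" "0 \<le> s * t"
      using assms by (simp_all add: algebra_simps)
    then show "a - p + z \<in> ray a d"
      unfolding ray_def by blast
  qed
  show "(a - p) + p = a + 0 *\<^sub>R d" "(a - p) + q = a + t *\<^sub>R d"
    using assms by simp_all
qed (use assms in simp_all)

theorem proposition3p2: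
  fixes X :: "('a::finite) config set" and P l :: "plane set"
  assumes "subshift X"
    and "coding_polygon X P"
    and "nonexpansive_ray X l"
  shows "\<exists>p q. oriented_edge P p q \<and> positively_parallel p q l"
proof -
  obtain a d where "d \<noteq> 0" and l: "l = ray a d" and nonexp: "\<not> expansive X (left_half_plane a d)"
    using assms(3) by (auto simp: nonexpansive_ray_def)
  have "polytope P" "aff_dim P = 2"
    and vertices: "{v. v extreme_point_of P} \<subseteq> range of_lattice"
    and code: "\<And>v. v extreme_point_of P \<Longrightarrow> codes X (P - {v}) {v}"
    using assms(2) by (auto simp: coding_polygon_def convex_integer_polygon_def)
  have "P \<noteq> {}"
    using \<open>aff_dim P = 2\<close> by auto
  from \<open>polytope P\<close> \<open>P \<noteq> {}\<close> \<open>d \<noteq> 0\<close> show ?thesis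
  proof (cases rule: minimal_vertex_or_edge)
    case (vertex v)
    obtain w where w: "v = of_lattice w"
      using vertices vertex(1) by blast
    have "\<And>u. shift u ` X \<subseteq> X"
      using assms(1) unfolding subshift_def by blast
    then have "expansive X (left_half_plane a d)"
      using polytope_imp_bounded[OF \<open>polytope P\<close>] code[OF vertex(1)] vertex(2) unfolding w
      by (rule expansive_if_strict_minimum_at_coded_vertex)
    with nonexp show ?thesis by contradiction
  next
    case (edge p q t)
    then show ?thesis
      using positively_parallel_ray[OF \<open>d \<noteq> 0\<close>] unfolding l by blast
  qed
qed

end
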